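(* Let $(f_D)_{D=1}^{\infty}$ be an increasing sequence of real numbers such that $(\Delta f_D)_{D=1}^\infty$, where $\Delta f_D:=f_{D+1}-f_D$, is decreasing. Then for every $X\in\mathbb{N}$ and every interval $[a,b]\subseteq[0,1]$, $$\Big|\#\{1\le D\le X\;|\;f_D\bmod 1\in[a,b]\}-(b-a)X\Big|<(3\pi+1)X^{1/2}f_{X+1}^{1/2}+\frac{\pi}{2}\cdot\frac{1}{\Delta f_{X+1}}.$$
   Context: For a real number $r$, $r\bmod 1:=r-\lfloor r\rfloor$.
   Formalization: The formal statement adds the assumption f_1 ≥ 0 (so all f_D ≥ 0), and reads "increasing" as strictly increasing; without f_1 ≥ 0 the square root may be undefined or the bound false, e.g. f_D = D − 5, X = 4, a = b = 0. *)

theory Defs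
  imports Complex_Main
begin

definition fwd_diff :: "(nat \<Rightarrow> real) \<Rightarrow> nat \<Rightarrow> real" where
  "fwd_diff f D = f (D + 1) - f D"

end

theory Submission
  imports Defs
begin

text \<open>
  Up to the number of \<open>D\<close> with \<open>frac (f D) = b\<close>, which is at most \<open>f (X + 1) + 1\<close>,
  the counting error is a difference of two sums of the sawtooth \<open>frac x - 1/2\<close> along shifts of \<open>f\<close>.
  The sawtooth has the periodic primitive \<open>(frac x ^ 2 - frac x) / 2\<close>, with values in \<open>[-1/8, 0]\<close>.
  Except when a step of \<open>f\<close> passes an integer, its value at \<open>f D\<close> is close to the difference quotient
  of the primitive over that step; the total cost of this replacement is \<open>O(f (X + 1) + 1)\<close>.
  The weights \<open>1 / fwd_diff f D\<close> increase, so Abel summation bounds the sum of the difference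
  quotients by a multiple of the last weight. This beats the claimed bound when
  \<open>1 \<le> f (X + 1) < X\<close>; otherwise the claim follows from the trivial bound \<open>X\<close>, using
  \<open>X * fwd_diff f (X + 1) \<le> f (X + 1)\<close> if \<open>f (X + 1) < 1\<close>.
\<close>

definition saw_prim :: "real \<Rightarrow> real" where
  "saw_prim x = ((frac x)\<^sup>2 - frac x) / 2"

lemma saw_prim_le_0: "saw_prim x \<le> 0"
proof -
  have "frac x * frac x \<le> 1 * frac x"
    using frac_ge_0[of x] frac_lt_1[of x] by (intro mult_right_mono) auto
  then show ?thesis by (simp add: saw_prim_def power2_eq_square)
qed

lemma saw_prim_ge: "- (1 / 8) \<le> saw_prim x"
proof -
  have "0 \<le> (frac x - 1 / 2)\<^sup>2" by simp
  then show ?thesis by (simp add: saw_prim_def power2_eq_square field_simps)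
qed

lemma frac_eq_add_floor_diff: "frac y = frac x + (y - x) - of_int (\<lfloor>y\<rfloor> - \<lfloor>x\<rfloor>)"
  by (simp add: frac_def)

text \<open>If no integer is passed, \<open>saw_prim\<close> is one quadratic polynomial on the step
  and its difference quotient misses the sawtooth by exactly \<open>(y - x) / 2\<close>. Otherwise
  the floor term is at least 1, which covers 1/2 for the sawtooth and 1/2 for the quotient.\<close>

lemma saw_approx:
  assumes "x < y"
  shows "\<bar>(frac x - 1 / 2) - (saw_prim y - saw_prim x) / (y - x)\<bar>
    \<le> (y - x) / 2 + of_int (\<lfloor>y\<rfloor> - \<lfloor>x\<rfloor>)"
proof (cases "\<lfloor>x\<rfloor> = \<lfloor>y\<rfloor>")
  case True
  then have fy: "frac y = frac x + (y - x)"
    using frac_eq_add_floor_diff[of y x] by simp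
  have "saw_prim y - saw_prim x = (y - x) * (frac x - 1 / 2 + (y - x) / 2)"
    unfolding saw_prim_def fy by (simp add: power2_eq_square field_simps)
  then have "(saw_prim y - saw_prim x) / (y - x) = frac x - 1 / 2 + (y - x) / 2"
    using assms by simp
  then show ?thesis using True assms by simp
next
  case False
  have "\<lfloor>x\<rfloor> \<le> \<lfloor>y\<rfloor>" using assms by (intro floor_mono) simp
  with False have "1 \<le> \<lfloor>y\<rfloor> - \<lfloor>x\<rfloor>" by linarith
  then have one: "(1::real) \<le> of_int (\<lfloor>y\<rfloor> - \<lfloor>x\<rfloor>)" by linarith
  then have gap: "(1 - frac x) + frac y \<le> y - x"
    using frac_eq_add_floor_diff[of y x] by linarith
  have x01: "0 \<le> frac x" "frac x < 1" and y01: "0 \<le> frac y" "frac y < 1"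
    by (simp_all add: frac_lt_1)
  \<comment> \<open>\<open>saw_prim\<close> vanishes at integers and has slope at most 1/2 in
    absolute value. Here \<open>1 - frac x\<close> and \<open>frac y\<close> are the distances to
    the first and last integer passed, and by \<open>gap\<close> they fit together into
    \<open>y - x\<close>.\<close>
  have "- saw_prim x \<le> (1 - frac x) / 2" "- saw_prim y \<le> frac y / 2"
    using zero_le_power2[of "1 - frac x"] zero_le_power2[of "frac y"]
    by (simp_all add: saw_prim_def power2_eq_square left_diff_distrib right_diff_distrib
        field_simps)
  then have "\<bar>saw_prim y - saw_prim x\<bar> \<le> (y - x) / 2"
    using gap saw_prim_le_0[of x] saw_prim_le_0[of y] x01 y01 by argo
  then have "\<bar>(saw_prim y - saw_prim x) / (y - x)\<bar> \<le> 1 / 2"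
    using assms by (simp add: abs_divide field_simps)
  then show ?thesis using one x01 assms by argo
qed

lemma abel_sum_bound:
  fixes w b :: "nat \<Rightarrow> real"
  assumes mono: "\<And>n. 1 \<le> n \<Longrightarrow> w n \<le> w (Suc n)" and nonneg: "0 \<le> w 1"
    and b: "\<And>n. - K \<le> b n" "\<And>n. b n \<le> 0" and "1 \<le> X"
  shows "\<bar>\<Sum>n=1..X. w n * (b (Suc n) - b n)\<bar> \<le> K * w X"
proof -
  let ?S = "\<lambda>X. \<Sum>n=1..X. w n * (b (Suc n) - b n)"
  \<comment> \<open>Keeping \<open>b (Suc X)\<close> in both bounds makes the induction work:
    \<open>b + K\<close> is nonnegative and \<open>b\<close> is nonpositive, so replacing
    \<open>w n\<close> by the larger \<open>w (Suc n)\<close> weakens each bound in the right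
    direction.\<close>
  have "0 \<le> w X \<and> ?S X \<le> w X * (b (Suc X) + K) \<and> w X * b (Suc X) \<le> ?S X"
    using \<open>1 \<le> X\<close>
  proof (induction X rule: nat_induct_at_least)
    case base
    have "0 \<le> w 1 * (b 1 + K)" "w 1 * b 1 \<le> 0"
      using b[of 1] nonneg by (simp_all add: mult_nonneg_nonpos)
    then show ?case using nonneg by (simp add: algebra_simps)
  next
    case (Suc n)
    have "w n * (b (Suc n) + K) \<le> w (Suc n) * (b (Suc n) + K)"
      "w (Suc n) * b (Suc n) \<le> w n * b (Suc n)"
      using b[of "Suc n"] mono[OF Suc.hyps]
      by (simp_all add: mult_right_mono mult_right_mono_neg)
    then show ?case using Suc.IH mono[OF Suc.hyps] by (simp add: algebra_simps)
  qed
  moreover have "w X * (b (Suc X) + K) \<le> w X * K" "- (w X * K) \<le> w X * b (Suc X)"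
    if "0 \<le> w X"
    using that b[of "Suc X"] mult_left_mono[of "- K" "b (Suc X)" "w X"]
    by (simp_all add: mult_left_mono)
  ultimately show ?thesis by (auto simp: abs_le_iff mult.commute)
qed

lemma sum_fwd_diff:
  fixes g :: "nat \<Rightarrow> 'a :: ab_group_add"
  shows "(\<Sum>n=1..X. g (Suc n) - g n) = g (Suc X) - g 1"
  by (induction X) simp_all

lemma fwd_diff_pos: "strict_mono_on {1..} f \<Longrightarrow> 1 \<le> n \<Longrightarrow> 0 < fwd_diff f n"
  by (simp add: fwd_diff_def strict_mono_on_def)

lemma saw_sum_bound:
  assumes f_incr: "strict_mono_on {1..} f" and diff_decr: "antimono_on {1..} (fwd_diff f)"
    and X: "1 \<le> X"
  shows "\<bar>\<Sum>n=1..X. frac (f n - c) - 1 / 2\<bar>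
    \<le> 3 / 2 * (f (Suc X) - f 1) + 1 + 1 / 8 * (1 / fwd_diff f X)"
proof -
  note pos = fwd_diff_pos[OF f_incr]
  let ?b = "\<lambda>n. saw_prim (f n - c)"
  let ?w = "\<lambda>n. 1 / fwd_diff f n"
  let ?e = "\<lambda>n. (frac (f n - c) - 1 / 2) - ?w n * (?b (Suc n) - ?b n)"
  let ?l = "\<lambda>n. real_of_int \<lfloor>f n - c\<rfloor>"
  have e: "\<bar>?e n\<bar> \<le> (f (Suc n) - f n) / 2 + (?l (Suc n) - ?l n)" if "n \<in> {1..X}" for n
    using saw_approx[of "f n - c" "f (Suc n) - c"] pos[of n] that
    by (simp add: fwd_diff_def)
  have "\<bar>\<Sum>n=1..X. ?e n\<bar> \<le> (\<Sum>n=1..X. (f (Suc n) - f n) / 2 + (?l (Suc n) - ?l n))"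
    using e by (intro order_trans[OF sum_abs] sum_mono)
  also have "\<dots> = (f (Suc X) - f 1) / 2 + (?l (Suc X) - ?l 1)"
    by (simp only: sum.distrib sum_divide_distrib[symmetric] sum_fwd_diff[of f]
        sum_fwd_diff[of ?l])
  \<comment> \<open>The telescoped floors differ by at most the total increase of \<open>f\<close>
    plus 1.\<close>
  also have "\<dots> \<le> 3 / 2 * (f (Suc X) - f 1) + 1"
    using of_int_floor_le[of "f (Suc X) - c"] real_of_int_floor_gt_diff_one[of "f 1 - c"]
    by (simp add: field_simps)
  finally have e_sum: "\<bar>\<Sum>n=1..X. ?e n\<bar> \<le> 3 / 2 * (f (Suc X) - f 1) + 1" .
  have "\<bar>\<Sum>n=1..X. ?w n * (?b (Suc n) - ?b n)\<bar> \<le> 1 / 8 * ?w X"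
  proof (rule abel_sum_bound)
    show "?w n \<le> ?w (Suc n)" if "1 \<le> n" for n
      using that pos[of n] pos[of "Suc n"] monotone_onD[OF diff_decr, of n "Suc n"]
      by (intro divide_left_mono mult_pos_pos) auto
    show "0 \<le> ?w 1" using pos[of 1] by simp
  qed (use X saw_prim_ge saw_prim_le_0 in auto)
  then show ?thesis using e_sum by (simp add: sum_subtractf)
qed

text \<open>Each hit makes \<open>f n - b\<close> an integer, so the ceiling of
  \<open>f n - b\<close> rises by at least 1 as soon as \<open>f\<close> moves on; these rises
  telescope. Ceilings, unlike floors, also register a hit at \<open>n = 1\<close>.\<close>

lemma card_frac_eq_le:
  assumes "strict_mono_on {1..} f"
  shows "real (card {n \<in> {1..X}. frac (f n) = b}) \<le> f (Suc X) - f 1 + 1"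
proof -
  let ?l = "\<lambda>n. real_of_int \<lceil>f n - b\<rceil>"
  have step: "of_bool (frac (f n) = b) \<le> ?l (Suc n) - ?l n" if "n \<in> {1..X}" for n
  proof -
    have lt: "f n < f (Suc n)" using fwd_diff_pos[OF assms, of n] that by (simp add: fwd_diff_def)
    show ?thesis
    proof (cases "frac (f n) = b")
      case True
      then have "f n - b = of_int \<lfloor>f n\<rfloor>" by (auto simp: frac_def)
      moreover from this have "\<lfloor>f n\<rfloor> < \<lceil>f (Suc n) - b\<rceil>" using lt by linarith
      ultimately show ?thesis using True by simp
    next
      case False
      have "\<lceil>f n - b\<rceil> \<le> \<lceil>f (Suc n) - b\<rceil>" using lt by (intro ceiling_mono) simp
      then show ?thesis using False by simp
    qed
  qed
  have "real (card {n \<in> {1..X}. frac (f n) = b}) = (\<Sum>n=1..X. of_bool (frac (f n) = b))"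
    by (simp add: Int_def)
  also have "\<dots> \<le> (\<Sum>n=1..X. ?l (Suc n) - ?l n)"
    using step by (rule sum_mono)
  also have "\<dots> = ?l (Suc X) - ?l 1"
    by (rule sum_fwd_diff)
  finally show ?thesis by linarith
qed

lemma frac_diff_eq:
  fixes c x :: real
  assumes "0 \<le> c" "c \<le> 1"
  shows "frac (x - c) = frac x - c + of_bool (frac x < c)"
proof -
  have "real_of_int \<lfloor>x\<rfloor> - 1 \<le> x - c"
    using assms of_int_floor_le[of x] by linarith
  then have "\<lfloor>x - c\<rfloor> = \<lfloor>x\<rfloor> - of_bool (frac x < c)"
    using assms frac_lt_1[of x] by (intro floor_unique) (auto simp: frac_def of_bool_def)
  then show ?thesis by (simp add: frac_def)
qed

text \<open>The difference of the two shifted sawtooths is the centred indicator of the half-open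
  interval from \<open>a\<close> to \<open>b\<close>; the last term restores the endpoint
  \<open>b\<close>.\<close>

lemma of_bool_frac_interval:
  fixes a b x :: real
  assumes "0 \<le> a" "a \<le> b" "b \<le> 1"
  shows "of_bool (frac x \<in> {a..b}) - (b - a)
    = (frac (x - b) - 1 / 2) - (frac (x - a) - 1 / 2) + of_bool (frac x = b)"
  using assms by (simp add: frac_diff_eq of_bool_def)

theorem theorem2p9:
  fixes f :: "nat \<Rightarrow> real"
  assumes f_incr: "strict_mono_on {1..} f"
    and diff_decr: "antimono_on {1..} (fwd_diff f)"
    and f_nonneg: "0 \<le> f 1"
  shows "\<forall>X::nat. \<forall>a b::real. 0 \<le> a \<and> a \<le> b \<and> b \<le> 1 \<longrightarrow>
    \<bar>real (card {D \<in> {1..X}. frac (f D) \<in> {a..b}}) - (b - a) * real X\<bar>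
      < (3 * pi + 1) * sqrt (real X) * sqrt (f (X + 1)) + pi / 2 * (1 / fwd_diff f (X + 1))"
proof (intro allI impI)
  fix X :: nat and a b :: real
  assume "0 \<le> a \<and> a \<le> b \<and> b \<le> 1"
  then have ab: "0 \<le> a" "a \<le> b" "b \<le> 1" by auto
  define N w q where "N = f (Suc X)" and "w = 1 / fwd_diff f (X + 1)"
    and "q = sqrt (real X) * sqrt N"
  let ?A = "{D \<in> {1..X}. frac (f D) \<in> {a..b}}"
  let ?E = "real (card ?A) - (b - a) * real X"
  note pos = fwd_diff_pos[OF f_incr] and anti = monotone_onD[OF diff_decr]
  have w: "0 < w" using pos[of "X + 1"] by (simp add: w_def)
  have "f 1 \<le> N" using strict_mono_onD[OF f_incr, of 1 "Suc X"] by (cases X) (auto simp: N_def)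
  then have N: "0 \<le> N" using f_nonneg by simp
  then have q: "0 \<le> q" by (simp add: q_def)
  have "\<bar>?E\<bar> \<le> real X"
  proof -
    have "card ?A \<le> X" using card_mono[of "{1..X}" ?A] by fastforce
    moreover have "0 \<le> (b - a) * real X" "(b - a) * real X \<le> 1 * real X"
      using ab by (simp_all add: mult_left_le_one_le)
    ultimately show ?thesis by linarith
  qed
  have XN: "real X \<le> N * w"
  proof -
    have "real X * fwd_diff f (X + 1) = (\<Sum>n=1..X. fwd_diff f (X + 1))" by simp
    also have "\<dots> \<le> (\<Sum>n=1..X. f (Suc n) - f n)"
      using anti[of _ "X + 1"] by (intro sum_mono) (auto simp: fwd_diff_def)
    also have "\<dots> = N - f 1" unfolding N_def by (rule sum_fwd_diff)
    finally have "real X * fwd_diff f (X + 1) \<le> N" using f_nonneg by simp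
    then show ?thesis using pos[of "X + 1"] by (simp add: w_def field_simps)
  qed
  consider "N < 1" | "real X \<le> N" "1 \<le> N" | "1 \<le> N" "N < real X" by linarith
  \<comment> \<open>The coefficients 7 and 1 are what \<open>3 * pi + 1\<close> and
    \<open>pi / 2\<close> become when \<open>pi\<close> is replaced by 2. Strictness comes from
    \<open>0 < w\<close>.\<close>
  then have "\<bar>?E\<bar> < 7 * q + w"
  proof cases
    case 1
    then have "real X < w" using XN mult_strict_right_mono[of N 1 w] w by linarith
    then show ?thesis using \<open>\<bar>?E\<bar> \<le> real X\<close> w q by linarith
  next
    case 2
    then have "real X \<le> q"
      using mult_left_mono[of "sqrt (real X)" "sqrt N" "sqrt (real X)"] by (simp add: q_def)
    then show ?thesis using \<open>\<bar>?E\<bar> \<le> real X\<close> w q by linarith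
  next
    case 3
    then have "N \<le> q"
      using mult_right_mono[of "sqrt N" "sqrt (real X)" "sqrt N"] by (simp add: q_def)
    have X: "1 \<le> X" using 3 by simp
    have "1 / fwd_diff f X \<le> w"
      unfolding w_def using X anti[of X "X + 1"] pos[of X] pos[of "X + 1"]
      by (intro divide_left_mono mult_pos_pos) auto
    then have S: "\<bar>\<Sum>n=1..X. frac (f n - c) - 1 / 2\<bar> \<le> 3 / 2 * N + 1 + 1 / 8 * w" for c
      using saw_sum_bound[OF f_incr diff_decr X, of c] f_nonneg
      unfolding N_def by argo
    have C: "real (card {n \<in> {1..X}. frac (f n) = b}) \<le> N + 1"
      using card_frac_eq_le[OF f_incr, of X b] f_nonneg by (simp add: N_def)
    have "?E = (\<Sum>n=1..X. of_bool (frac (f n) \<in> {a..b}) - (b - a))"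
      by (simp add: sum_subtractf Int_def mult.commute)
    also have "\<dots> = (\<Sum>n=1..X. frac (f n - b) - 1 / 2) - (\<Sum>n=1..X. frac (f n - a) - 1 / 2)
        + (\<Sum>n=1..X. of_bool (frac (f n) = b))"
      by (simp only: of_bool_frac_interval[OF ab] sum.distrib sum_subtractf)
    also have "(\<Sum>n=1..X. of_bool (frac (f n) = b)) = real (card {n \<in> {1..X}. frac (f n) = b})"
      by (simp add: Int_def)
    \<comment> \<open>Two sawtooth sums contribute \<open>3 * N + 2 + 1 / 4 * w\<close> and the
      endpoint count \<open>N + 1\<close>. As \<open>1 \<le> N\<close>, the part without
      \<open>w\<close> is at most \<open>7 * N\<close>.\<close>
    finally have "\<bar>?E\<bar> \<le> 4 * N + 3 + 1 / 4 * w"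
      using S[of a] S[of b] C by linarith
    then show ?thesis using \<open>1 \<le> N\<close> \<open>N \<le> q\<close> w by linarith
  qed
  also have "\<dots> \<le> (3 * pi + 1) * q + pi / 2 * w"
    using pi_ge_two q w mult_right_mono[of 1 "pi / 2" w] by (intro add_mono mult_right_mono) auto
  finally show "\<bar>?E\<bar> < (3 * pi + 1) * sqrt (real X) * sqrt (f (X + 1))
      + pi / 2 * (1 / fwd_diff f (X + 1))"
    by (simp add: q_def N_def w_def mult.assoc)
qed

end
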